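(* Let $n$ be an odd positive integer, let $m\le M$ be real numbers and let $x_1,\dots,x_n$ be real numbers with $m\le x_i\le M$ for $i=1,\dots,n$. Let $\overline{x}=\frac1n\sum_{i=1}^n x_i$ and $m_r=\frac1n\sum_{i=1}^n (x_i-\overline{x})^r$ for $r=2,4$. Then $$m_4+3m_2^2\le \frac{n^2-1}{4n^2}(M-m)^4.$$
   Context: $m_r$ (with a subscript) denotes the $r$-th central moment of $x_1,\dots,x_n$; $m$ (without subscript) is a lower bound for the $x_i$. *)

theory Defs
  imports Complex_Main
begin

definition mean :: "nat \<Rightarrow> (nat \<Rightarrow> real) \<Rightarrow> real" where
  "mean n x = (1 / real n) * (\<Sum>i=1..n. x i)"

definition central_moment :: "nat \<Rightarrow> nat \<Rightarrow> (nat \<Rightarrow> real) \<Rightarrow> real" where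
  "central_moment r n x = (1 / real n) * (\<Sum>i=1..n. (x i - mean n x) ^ r)"

end

theory Submission
  imports Defs
begin

text \<open>
  Since the central moments satisfy
  \<open>m\<^sub>4 + 3 m\<^sub>2\<^sup>2 = (1 / 2n\<^sup>2) \<Sum>\<^sub>i\<^sub>j (x\<^sub>i - x\<^sub>j)\<^sup>4\<close> and \<open>\<bar>x\<^sub>i - x\<^sub>j\<bar> \<le> M - m\<close>, it suffices to bound
  \<open>\<Sum>\<^sub>i\<^sub>j \<bar>x\<^sub>i - x\<^sub>j\<bar>\<close>. Remove a smallest and a largest value: for every other \<open>x\<^sub>k\<close> the two
  distances to them add up to at most \<open>M - m\<close>, so for odd \<open>n\<close> induction in steps of two gives
  the bound \<open>(n\<^sup>2 - 1) (M - m) / 2\<close>.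
\<close>

text \<open>Binomial expansion; swapping \<open>i\<close> and \<open>j\<close> merges the outer
  terms and the two mixed cubic terms. The cubic term keeps the factor \<Sum> \<open>y i\<close>,
  which vanishes for centred values.\<close>

lemma sum_diff_power4:
  fixes y :: "'a \<Rightarrow> real"
  shows "(\<Sum>i\<in>A. \<Sum>j\<in>A. (y i - y j) ^ 4) =
    2 * real (card A) * (\<Sum>i\<in>A. y i ^ 4) - 8 * (\<Sum>i\<in>A. y i) * (\<Sum>i\<in>A. y i ^ 3)
      + 6 * (\<Sum>i\<in>A. (y i)\<^sup>2)\<^sup>2"
proof -
  have expand: "(y i - y j) ^ 4 =
      y i ^ 4 - 4 * (y i ^ 3 * y j) + 6 * ((y i)\<^sup>2 * (y j)\<^sup>2) - 4 * (y i * y j ^ 3) + y j ^ 4"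
    for i j by algebra
  show ?thesis
    unfolding expand sum.distrib sum_subtractf
    by (simp add: sum_distrib_left[symmetric] sum_distrib_right[symmetric] power2_eq_square)
qed

text \<open>Centring leaves the differences unchanged and makes the deviations sum to zero, so only
  the fourth powers and the squared sum of squares survive.\<close>

lemma central_moment_4_2_eq_sum_diff:
  assumes "n > 0"
  shows "central_moment 4 n x + 3 * (central_moment 2 n x)\<^sup>2 =
    (\<Sum>i=1..n. \<Sum>j=1..n. (x i - x j) ^ 4) / (2 * (real n)\<^sup>2)"
proof -
  define y where "y i = x i - mean n x" for i
  have "(\<Sum>i=1..n. y i) = 0"
    using assms by (simp add: y_def sum_subtractf mean_def)
  then have "(\<Sum>i=1..n. \<Sum>j=1..n. (x i - x j) ^ 4) =
      2 * real n * (\<Sum>i=1..n. y i ^ 4) + 6 * (\<Sum>i=1..n. (y i)\<^sup>2)\<^sup>2"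
    using sum_diff_power4[of y "{1..n}"] by (simp add: y_def)
  then show ?thesis
    using assms unfolding central_moment_def y_def[symmetric]
    by (simp add: field_simps power2_eq_square)
qed

text \<open>Oddness makes the descent by two end at a singleton, where both sides are 0. The bound
  is attained when the values split between \<open>m\<close> and \<open>M\<close> as evenly as
  possible.\<close>

lemma sum_abs_diff_le:
  fixes x :: "'a \<Rightarrow> real"
  assumes "finite A" "odd (card A)" "\<And>i. i \<in> A \<Longrightarrow> m \<le> x i \<and> x i \<le> M"
  shows "(\<Sum>i\<in>A. \<Sum>j\<in>A. \<bar>x i - x j\<bar>) \<le> ((real (card A))\<^sup>2 - 1) / 2 * (M - m)"
  using assms
proof (induction "card A" arbitrary: A rule: less_induct)
  case less
  show ?case
  proof (cases "card A = 1")
    case True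
    then show ?thesis by (auto simp: card_1_singleton_iff)
  next
    case False
    then have card3: "card A \<ge> 3"
      using less.prems(2) by (auto elim!: oddE)
    then have "A \<noteq> {}" by auto
    then obtain a where a: "a \<in> A" "\<And>k. k \<in> A \<Longrightarrow> x a \<le> x k"
      using ex_is_arg_min_if_finite[of A x] less.prems(1) by (auto simp: is_arg_min_linorder)
    \<comment> \<open>Choosing the maximum only after deleting \<open>a\<close> keeps
      \<open>a\<close> and \<open>b\<close> distinct even if all values coincide.\<close>
    define A' where "A' = A - {a}"
    have A': "finite A'" "A' \<noteq> {}"
      using less.prems(1) card3 a(1) unfolding A'_def
      by (auto simp: subset_singleton_iff)
    then obtain b where b: "b \<in> A'" "\<And>k. k \<in> A' \<Longrightarrow> x k \<le> x b"
      using ex_is_arg_min_if_finite[of A' "\<lambda>k. - x k"] by (auto simp: is_arg_min_linorder)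
    define B where "B = A' - {b}"
    have A_eq: "A = insert a (insert b B)" and fin: "finite B" and nin: "a \<notin> insert b B" "b \<notin> B"
      using a b A' by (auto simp: A'_def B_def)
    then have cA: "card A = card B + 2" by simp
    have IH: "(\<Sum>i\<in>B. \<Sum>j\<in>B. \<bar>x i - x j\<bar>) \<le> ((real (card B))\<^sup>2 - 1) / 2 * (M - m)"
      using less.hyps[of B] less.prems fin cA by (simp add: A_eq)
    have gap: "\<bar>x a - x k\<bar> + \<bar>x b - x k\<bar> = x b - x a" if "k \<in> B" for k
      using a(2)[of k] b(2)[of k] that by (auto simp: A_eq B_def)
    have ab: "x a \<le> x b" "x b - x a \<le> M - m"
      using a b less.prems(3)[of a] less.prems(3)[of b] by (auto simp: A'_def)
    have "(\<Sum>k\<in>B. \<bar>x a - x k\<bar>) + (\<Sum>k\<in>B. \<bar>x b - x k\<bar>) = real (card B) * (x b - x a)"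
      using gap by (simp add: sum.distrib[symmetric])
    \<comment> \<open>The double sum runs over ordered pairs, so each pair meeting \<open>a\<close>
      or \<open>b\<close> counts twice.\<close>
    moreover have "(\<Sum>i\<in>A. \<Sum>j\<in>A. \<bar>x i - x j\<bar>) = (\<Sum>i\<in>B. \<Sum>j\<in>B. \<bar>x i - x j\<bar>)
        + 2 * ((\<Sum>k\<in>B. \<bar>x a - x k\<bar>) + (\<Sum>k\<in>B. \<bar>x b - x k\<bar>)) + 2 * (x b - x a)"
      using fin nin ab(1) by (simp add: A_eq sum.distrib abs_minus_commute)
    ultimately have "(\<Sum>i\<in>A. \<Sum>j\<in>A. \<bar>x i - x j\<bar>) =
        (\<Sum>i\<in>B. \<Sum>j\<in>B. \<bar>x i - x j\<bar>) + 2 * (real (card B) + 1) * (x b - x a)"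
      by (simp add: algebra_simps)
    also have "\<dots> \<le> ((real (card B))\<^sup>2 - 1) / 2 * (M - m) + 2 * (real (card B) + 1) * (M - m)"
      using IH ab(2) by (intro add_mono mult_left_mono) auto
    \<comment> \<open>With c = \<open>card B\<close>: (c^2 - 1) + 4(c + 1) = (c + 2)^2 - 1.\<close>
    also have "\<dots> = ((real (card A))\<^sup>2 - 1) / 2 * (M - m)"
      by (simp add: cA field_simps power2_eq_square)
    finally show ?thesis .
  qed
qed

theorem corollary2p3:
  fixes n :: nat and m M :: real and x :: "nat \<Rightarrow> real"
  assumes "n > 0" and "odd n"
    and "m \<le> M"
    and "\<And>i. 1 \<le> i \<Longrightarrow> i \<le> n \<Longrightarrow> m \<le> x i \<and> x i \<le> M"
  shows "central_moment 4 n x + 3 * (central_moment 2 n x)\<^sup>2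
         \<le> ((real n)\<^sup>2 - 1) / (4 * (real n)\<^sup>2) * (M - m) ^ 4"
proof -
  \<comment> \<open>Three of the four factors are bounded by \<open>M - m\<close>. Nothing is lost
    when all values lie at \<open>m\<close> or \<open>M\<close>.\<close>
  have pair: "(x i - x j) ^ 4 \<le> (M - m) ^ 3 * \<bar>x i - x j\<bar>"
    if "i \<in> {1..n}" "j \<in> {1..n}" for i j
  proof -
    have "\<bar>x i - x j\<bar> \<le> M - m"
      using assms(4)[of i] assms(4)[of j] that by auto
    then have "\<bar>x i - x j\<bar> ^ 3 * \<bar>x i - x j\<bar> \<le> (M - m) ^ 3 * \<bar>x i - x j\<bar>"
      by (intro mult_right_mono power_mono) auto
    moreover have "(x i - x j) ^ 4 = \<bar>x i - x j\<bar> ^ 3 * \<bar>x i - x j\<bar>"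
      by (simp add: power_Suc2[symmetric] del: power_Suc)
    ultimately show ?thesis by simp
  qed
  have "(\<Sum>i=1..n. \<Sum>j=1..n. (x i - x j) ^ 4)
      \<le> (M - m) ^ 3 * (\<Sum>i=1..n. \<Sum>j=1..n. \<bar>x i - x j\<bar>)"
    unfolding sum_distrib_left by (intro sum_mono pair)
  also have "\<dots> \<le> (M - m) ^ 3 * (((real n)\<^sup>2 - 1) / 2 * (M - m))"
    using sum_abs_diff_le[of "{1..n}" m x M] assms by (intro mult_left_mono) auto
  also have "\<dots> = ((real n)\<^sup>2 - 1) / 2 * (M - m) ^ 4"
    by (simp add: power3_eq_cube power4_eq_xxxx)
  finally have "(\<Sum>i=1..n. \<Sum>j=1..n. (x i - x j) ^ 4) / (2 * (real n)\<^sup>2)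
      \<le> (((real n)\<^sup>2 - 1) / 2 * (M - m) ^ 4) / (2 * (real n)\<^sup>2)"
    by (rule divide_right_mono) simp
  then show ?thesis
    by (simp add: central_moment_4_2_eq_sum_diff[OF assms(1)])
qed

end
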